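(* Let $p$ be a prime and let $A,\Gamma\subset\mathbb{F}_p^*$ be two multiplicative subgroups. Suppose that $A-A=\xi\Gamma\sqcup\{0\}$ for some $\xi\in\mathbb{F}_p^*$, and that $(A\circ A)(x)=c$ is a constant for all $x\in\xi\Gamma$. Then $|A|^2-|A|=c|\Gamma|$, and either $|\Gamma|=O(1)$ or $|\Gamma|\gg\frac{p}{\log p}$.
   Context: For a set $A\subseteq\mathbb{F}_p$ (identified with its indicator function), $(A\circ A)(x)=\sum_{y\in\mathbb{F}_p}A(y)A(y+x)=|\{(a,a')\in A^2: a'-a=x\}|$. $X\ll Y$ means $X\le cY$ with an absolute constant $c$. *)

theory Defs
  imports Complex_Main "HOL-Computational_Algebra.Primes"
begin

text \<open>F_p is modelled by the residues {0..<p} :: int set, with arithmetic mod p.\<close>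

definition mult_subgroup :: "int \<Rightarrow> int set \<Rightarrow> bool" where
  "mult_subgroup p G \<longleftrightarrow> G \<subseteq> {1..<p} \<and> 1 \<in> G \<and>
     (\<forall>x\<in>G. \<forall>y\<in>G. (x * y) mod p \<in> G) \<and>
     (\<forall>x\<in>G. \<exists>y\<in>G. (x * y) mod p = 1)"

definition diff_set :: "int \<Rightarrow> int set \<Rightarrow> int set" where
  "diff_set p A = {(a' - a) mod p | a a'. a \<in> A \<and> a' \<in> A}"

definition dilate :: "int \<Rightarrow> int \<Rightarrow> int set \<Rightarrow> int set" where
  "dilate p \<xi> G = {(\<xi> * g) mod p | g. g \<in> G}"

definition self_corr :: "int \<Rightarrow> int set \<Rightarrow> int \<Rightarrow> nat" where
  "self_corr p A x = card {(a, a'). a \<in> A \<and> a' \<in> A \<and> (a' - a) mod p = x}"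

end

theory Submission
  imports Defs "HOL-Number_Theory.Cong" "HOL-Computational_Algebra.Polynomial"
begin

text \<open>
  Let $n = |A|$, $d = |\Gamma|$ and assume $\Gamma \ne F_p^*$. Following Stepanov's method in the form
  of Hanson and Petridis, consider $F(x) = \sum_{a \in A} a (x - a)^N$ with $N = d + n - 1 < p$. All
  $(a - b)^d$ with $a \ne b$ in $A$ equal $\xi^d$, so the derivatives of $F$ of orders $1, \dots, n - 2$
  vanish at $1$. As $A$ is a group and $d = n e$, $F$ is up to sign and the factor $n$ the polynomial
  $\sum_{m \le e} w_m y^m$ in $y = x^n$ with $w_m = (-1)^{nm} {N \choose nm}$, whose coefficients do not
  vanish. Hence $e \ge n - 1$. Since $n (n - 1) = c d$, this forces $c = 1$, $e = n - 1$, $N = n^2 - 1$,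
  and makes the nonconstant part of the polynomial proportional to that of $(1 - y)^{n - 1}$. The ratios
  of consecutive coefficients then show that
  $D(z) = \prod_{i=1}^{n-1} (z + i) - \prod_{i=1}^{n-1} (z - n (n - 1) - i)$, which has degree $n - 2$,
  vanishes modulo $p$ at $z = n, 2n, \dots, (n - 2) n$, so that
  $D(z) = n^2 (n - 1) \prod_{l=1}^{n-2} (z - n l)$ modulo $p$. Comparing the coefficients of $z^{n-4}$
  gives $p \mid n^3 (n - 1)^2 (n - 2) (n - 3) (n + 1)^2$, which is impossible for $n \ge 4$. So either
  $\Gamma = F_p^*$ or $n \le 3$ and $d \le 6$.
\<close>

section \<open>Multiplicative subgroups of the residues\<close>

text \<open>Lagrange's root bound over F_p, phrased for integer coefficients: a root
  \<open>r\<close> is split off by synthetic division, and the other points, being incongruent to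
  \<open>r\<close>, remain roots of the quotient modulo \<open>p\<close>.\<close>

lemma prime_dvd_coeff_if_many_roots:
  fixes p :: int and P :: "int poly"
  assumes "prime p" "finite S" "degree P < card S"
    and "\<And>s. s \<in> S \<Longrightarrow> p dvd poly P s"
    and "\<And>s t. s \<in> S \<Longrightarrow> t \<in> S \<Longrightarrow> s \<noteq> t \<Longrightarrow> \<not> p dvd s - t"
  shows "p dvd coeff P k"
  using assms(2-5)
proof (induction "card S" arbitrary: S P k)
  case 0
  then show ?case by simp
next
  case (Suc m)
  obtain r where r: "r \<in> S" using Suc.hyps(2) by fastforce
  define Q where "Q = synthetic_div P r"
  have P: "P = [:-r, 1:] * Q + [:poly P r:]"
    unfolding Q_def by (rule synthetic_div_correct'[symmetric])
  have "p dvd coeff Q j" for j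
  \<comment> \<open>For constant \<open>P\<close> the quotient is 0, but its degree need not lie
    below \<open>card (S - {r})\<close>, which may be 0; hence the separate case.\<close>
  proof (cases "degree P = 0")
    case True
    then have "Q = 0" unfolding Q_def by (simp add: synthetic_div_eq_0_iff)
    then show ?thesis by simp
  next
    case False
    have "p dvd poly Q s" if "s \<in> S - {r}" for s
    proof -
      have "poly P s = (s - r) * poly Q s + poly P r"
        by (subst P) (simp add: algebra_simps)
      then have "p dvd (s - r) * poly Q s"
        using Suc.prems(3) r that by (metis Diff_iff dvd_add_left_iff)
      then show ?thesis
        using Suc.prems(4)[of s r] r that assms(1) by (auto simp: prime_dvd_mult_iff)
    qed
    moreover have "degree Q < card (S - {r})" "m = card (S - {r})"
      using False Suc r unfolding Q_def by (auto simp: degree_synthetic_div)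
    ultimately show ?thesis
      using Suc.hyps(1)[of "S - {r}" Q j] Suc.prems by auto
  qed
  moreover have "p dvd poly P r" using Suc.prems r by blast
  ultimately show ?case
    by (subst P) (auto simp: coeff_pCons split: nat.split)
qed

lemma mult_subgroup_finite: "mult_subgroup p A \<Longrightarrow> finite A"
  unfolding mult_subgroup_def by (meson finite_atLeastLessThan_int finite_subset)

lemma mult_subgroup_not_dvd: "mult_subgroup p A \<Longrightarrow> a \<in> A \<Longrightarrow> \<not> p dvd a"
  unfolding mult_subgroup_def using zdvd_not_zless by fastforce

lemma residue_not_dvd_diff:
  fixes p :: int
  assumes "a \<in> {0..<p}" "b \<in> {0..<p}" "a \<noteq> b"
  shows "\<not> p dvd a - b"
  using assms by (metis atLeastLessThan_iff mod_eq_dvd_iff mod_pos_pos_trivial)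

lemma mult_subgroup_not_dvd_diff:
  assumes "mult_subgroup p A" "a \<in> A" "b \<in> A" "a \<noteq> b"
  shows "\<not> p dvd a - b"
  by (rule residue_not_dvd_diff) (use assms in \<open>auto simp: mult_subgroup_def\<close>)

lemma inj_on_mult_mod:
  fixes p :: int
  assumes "prime p" "\<not> p dvd g" "X \<subseteq> {0..<p}"
  shows "inj_on (\<lambda>x. (x * g) mod p) X"
proof (rule inj_onI, rule ccontr)
  fix x y assume *: "x \<in> X" "y \<in> X" "x * g mod p = y * g mod p" "x \<noteq> y"
  then have "p dvd (x - y) * g" by (simp add: mod_eq_dvd_iff algebra_simps)
  then have "p dvd x - y" using assms by (simp add: prime_dvd_mult_iff)
  then show False using residue_not_dvd_diff[of x p y] * assms(3) by (meson subsetD)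
qed

lemma mult_subgroup_translate:
  assumes "prime p" "mult_subgroup p A" "g \<in> A"
  shows "bij_betw (\<lambda>x. (x * g) mod p) A A"
proof -
  have "inj_on (\<lambda>x. (x * g) mod p) A"
    using assms mult_subgroup_not_dvd[OF assms(2,3)]
    by (intro inj_on_mult_mod) (auto simp: mult_subgroup_def)
  moreover have "(\<lambda>x. (x * g) mod p) ` A \<subseteq> A"
    using assms unfolding mult_subgroup_def by auto
  ultimately show ?thesis
    using mult_subgroup_finite[OF assms(2)] by (simp add: bij_betw_def endo_inj_surj)
qed

text \<open>Fermat's argument: multiplication by \<open>g\<close> permutes \<open>A\<close>, so the
  product of all elements, a unit, is unchanged when multiplied by
  \<open>g ^ card A\<close>.\<close>

lemma mult_subgroup_power_card:
  assumes "prime p" "mult_subgroup p A" "g \<in> A"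
  shows "[g ^ card A = 1] (mod p)"
proof -
  have "(\<Prod>x\<in>A. x) = (\<Prod>x\<in>A. (x * g) mod p)"
    using prod.reindex_bij_betw[OF mult_subgroup_translate[OF assms], of "\<lambda>x. x"] by simp
  also have "[\<dots> = (\<Prod>x\<in>A. x * g)] (mod p)"
    by (intro cong_prod) (simp add: cong_def)
  also have "(\<Prod>x\<in>A. x * g) = (\<Prod>x\<in>A. x) * g ^ card A"
    by (simp add: prod.distrib)
  finally have "p dvd (\<Prod>x\<in>A. x) * (g ^ card A - 1)"
    by (simp add: cong_iff_dvd_diff algebra_simps dvd_diff_commute)
  moreover have "\<not> p dvd (\<Prod>x\<in>A. x)"
    using assms mult_subgroup_finite[OF assms(2)] mult_subgroup_not_dvd[OF assms(2)]
    by (simp add: prime_dvd_prod_iff)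
  ultimately show ?thesis
    using assms(1) by (simp add: prime_dvd_mult_iff cong_iff_dvd_diff)
qed

text \<open>\<open>A\<close> acts on \<open>X\<close> by multiplication, freely because the elements
  of \<open>X\<close> are units, so the orbits all have size \<open>card A\<close>. Applied below
  both to a coset and to the set of all nonzero residues.\<close>

lemma mult_subgroup_card_dvd:
  assumes p: "prime p" and A: "mult_subgroup p A" and X: "X \<subseteq> {1..<p}"
    and closed: "\<And>a x. a \<in> A \<Longrightarrow> x \<in> X \<Longrightarrow> (a * x) mod p \<in> X"
  shows "card A dvd card X"
proof -
  define R where "R = {(x, y). x \<in> X \<and> (\<exists>a\<in>A. y = (a * x) mod p)}"
  have mod_X: "x mod p = x" if "x \<in> X" for x using X that by auto
  have one: "1 \<in> A" using A by (simp add: mult_subgroup_def)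
  have "equiv X R"
  proof (rule equivI)
    show "R \<subseteq> X \<times> X" using closed by (auto simp: R_def)
    show "refl_on X R"
      using one mod_X closed by (force simp: R_def refl_on_def)
    show "sym R"
    proof (rule symI)
      fix x y assume "(x, y) \<in> R"
      then obtain a where a: "x \<in> X" "a \<in> A" "y = (a * x) mod p" by (auto simp: R_def)
      obtain b where b: "b \<in> A" "(a * b) mod p = 1"
        using A a(2) by (auto simp: mult_subgroup_def)
      have "(b * y) mod p = ((a * b) mod p * x) mod p"
        unfolding a(3) by (simp add: mod_simps mult.assoc mult.left_commute)
      also have "\<dots> = x" using b mod_X a by simp
      finally have "x = (b * y) mod p" ..
      moreover have "y \<in> X" using a closed by simp
      ultimately show "(y, x) \<in> R" using b by (auto simp: R_def)
    qed
    show "trans R"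
    proof (rule transI)
      fix x y z assume "(x, y) \<in> R" "(y, z) \<in> R"
      then obtain a b where *: "x \<in> X" "a \<in> A" "b \<in> A" "z = (b * ((a * x) mod p)) mod p"
        by (auto simp: R_def)
      have "z = ((b * a) mod p * x) mod p" unfolding * by (simp add: mod_simps mult.assoc)
      moreover have "(b * a) mod p \<in> A" using * A by (auto simp: mult_subgroup_def)
      ultimately show "(x, z) \<in> R" using * by (auto simp: R_def)
    qed
  qed
  moreover have "card A dvd card C" if C: "C \<in> X // R" for C
  proof -
    obtain x where x: "x \<in> X" "C = R `` {x}" using C by (auto elim: quotientE)
    have "C = (\<lambda>a. (a * x) mod p) ` A" using x by (auto simp: R_def)
    moreover have "inj_on (\<lambda>a. (a * x) mod p) A"
      using p A X x(1) zdvd_not_zless[of x p]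
      by (intro inj_on_mult_mod) (auto simp: mult_subgroup_def)
    ultimately show ?thesis by (simp add: card_image)
  qed
  moreover have "finite X" using X finite_subset by blast
  ultimately show ?thesis using equiv_imp_dvd_card by blast
qed

section \<open>Power sums over a subgroup\<close>

text \<open>Multiplication by \<open>g\<close> permutes the summands and scales the sum by
  \<open>g ^ j\<close>, so one \<open>g\<close> with \<open>g ^ j\<close> different from 1 suffices.
  It exists because x^i - 1 with 0 < i < |A| has too few roots to vanish on
  \<open>A\<close>.\<close>

lemma mult_subgroup_power_sum_eq_0:
  assumes p: "prime p" and A: "mult_subgroup p A" and j: "\<not> card A dvd j"
  shows "[(\<Sum>a\<in>A. a ^ j) = 0] (mod p)"
proof -
  define i where "i = j mod card A"
  have fin: "finite A" and "1 \<in> A" using mult_subgroup_finite[OF A] A by (auto simp: mult_subgroup_def)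
  then have "card A > 0" by (auto simp: card_gt_0_iff)
  then have i: "0 < i" "i < card A" using j by (auto simp: i_def dvd_eq_mod_eq_0)
  have red: "[a ^ j = a ^ i] (mod p)" if "a \<in> A" for a
  proof -
    have "a ^ j = (a ^ card A) ^ (j div card A) * a ^ i"
      by (simp add: i_def flip: power_mult power_add)
    also have "[\<dots> = 1 ^ (j div card A) * a ^ i] (mod p)"
      by (intro cong_mult cong_pow cong_refl mult_subgroup_power_card assms that)
    finally show ?thesis by simp
  qed
  have "\<exists>g\<in>A. \<not> p dvd g ^ i - 1"
  proof (rule ccontr)
    assume "\<not> ?thesis"
    then have *: "\<And>a. a \<in> A \<Longrightarrow> p dvd poly (monom 1 i - 1) a"
      by (simp add: poly_monom)
    have "degree (monom 1 i - 1 :: int poly) \<le> i"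
      by (rule degree_diff_le) (simp_all add: degree_monom_le)
    \<comment> \<open>The constant coefficient is -1 because i > 0, so \<open>p\<close> would divide
      a unit.\<close>
    then have "p dvd coeff (monom 1 i - 1) 0"
      by (intro prime_dvd_coeff_if_many_roots[OF p fin])
        (use i * mult_subgroup_not_dvd_diff[OF A] in auto)
    then show False using i p not_prime_unit by auto
  qed
  then obtain g where g: "g \<in> A" "\<not> p dvd g ^ i - 1" by blast
  have "(\<Sum>a\<in>A. a ^ j) = (\<Sum>a\<in>A. ((a * g) mod p) ^ j)"
    using sum.reindex_bij_betw[OF mult_subgroup_translate[OF p A g(1)], of "\<lambda>x. x ^ j"] by simp
  also have "[\<dots> = (\<Sum>a\<in>A. a ^ j * g ^ j)] (mod p)"
    by (intro cong_sum) (simp add: cong_def power_mod flip: power_mult_distrib)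
  also have "(\<Sum>a\<in>A. a ^ j * g ^ j) = (\<Sum>a\<in>A. a ^ j) * g ^ j"
    by (simp add: sum_distrib_right)
  also have "[\<dots> = (\<Sum>a\<in>A. a ^ j) * g ^ i] (mod p)"
    by (intro cong_mult cong_refl red g)
  finally have "p dvd (\<Sum>a\<in>A. a ^ j) * (g ^ i - 1)"
    by (simp add: cong_iff_dvd_diff algebra_simps dvd_diff_commute)
  then show ?thesis using p g(2) by (simp add: prime_dvd_mult_iff cong_iff_dvd_diff)
qed

lemma mult_subgroup_power_sum_eq_card:
  assumes "prime p" "mult_subgroup p A" "card A dvd j"
  shows "[(\<Sum>a\<in>A. a ^ j) = int (card A)] (mod p)"
proof -
  obtain k where k: "j = card A * k" using assms(3) by blast
  have "[(\<Sum>a\<in>A. a ^ j) = (\<Sum>a\<in>A. 1 ^ k)] (mod p)"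
    unfolding k power_mult
    by (intro cong_sum cong_pow mult_subgroup_power_card assms)
  then show ?thesis by simp
qed

text \<open>Binomial expansion reduces the sum to power sums. The extra factor \<open>a\<close>
  shifts the exponents by one, so the surviving indices satisfy \<open>card A dvd Suc i\<close>,
  which matches N + 1 = n (e + 1) later on.\<close>

lemma mult_subgroup_twisted_sum:
  assumes "prime p" "mult_subgroup p A"
  shows "[(\<Sum>a\<in>A. a * (1 - a) ^ T) =
    (\<Sum>i\<le>T. (-1) ^ i * int (T choose i) * (if card A dvd Suc i then int (card A) else 0))] (mod p)"
proof -
  have "a * (1 - a) ^ T = (\<Sum>i\<le>T. (-1) ^ i * int (T choose i) * a ^ Suc i)" for a
    using binomial_ring[of "- a" 1 T] by (simp add: sum_distrib_left power_minus[of a] algebra_simps)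
  then have "(\<Sum>a\<in>A. a * (1 - a) ^ T) = (\<Sum>a\<in>A. \<Sum>i\<le>T. (-1) ^ i * int (T choose i) * a ^ Suc i)"
    by simp
  also have "\<dots> = (\<Sum>i\<le>T. (-1) ^ i * int (T choose i) * (\<Sum>a\<in>A. a ^ Suc i))"
    by (subst sum.swap) (simp add: sum_distrib_left)
  also have "[\<dots> = (\<Sum>i\<le>T. (-1) ^ i * int (T choose i) * (if card A dvd Suc i then int (card A) else 0))] (mod p)"
    using mult_subgroup_power_sum_eq_0[OF assms] mult_subgroup_power_sum_eq_card[OF assms]
    by (intro cong_sum cong_mult cong_refl) (simp del: power_Suc)
  finally show ?thesis .
qed

lemma mult_subgroup_twisted_sum_eq_0:
  assumes "prime p" "mult_subgroup p A" "Suc T < card A"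
  shows "[(\<Sum>a\<in>A. a * (1 - a) ^ T) = 0] (mod p)"
proof -
  have "\<not> card A dvd Suc i" if "i \<le> T" for i
    using assms(3) that by (auto dest: dvd_imp_le)
  then show ?thesis using mult_subgroup_twisted_sum[OF assms(1,2), of T] by simp
qed

section \<open>Weights with vanishing moments\<close>

lemma prod_diff_eq_fact_binomial:
  "(\<Prod>i<k. int n - int i) = fact k * int (n choose k)"
proof -
  have "of_int (\<Prod>i<k. int n - int i) = (\<Prod>i=0..<k. (of_nat n :: rat) - of_nat i)"
    by (simp add: atLeast0LessThan)
  also have "\<dots> = fact k * (of_nat n gchoose k)"
    by (simp add: gbinomial_mult_fact)
  also have "\<dots> = of_int (fact k * int (n choose k))"
    by (simp add: binomial_gbinomial)
  finally show ?thesis by (simp only: of_int_eq_iff)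
qed

text \<open>As polynomials in m, the k! binom(nm, k) have degree k, no constant term for k \<ge> 1,
  and leading coefficient n^k, a unit modulo \<open>p\<close>. They therefore generate all test
  polynomials without constant term; the induction strips the top coefficient of
  \<open>q\<close>.\<close>

lemma prime_dvd_poly_moment:
  fixes p :: int and w :: "nat \<Rightarrow> int"
  assumes p: "prime p" "\<not> p dvd int n"
    and binom: "\<And>k. 1 \<le> k \<Longrightarrow> k \<le> K \<Longrightarrow> p dvd (\<Sum>m\<in>M. w m * int (n * m choose k))"
    and q: "degree q \<le> K" "coeff q 0 = 0"
  shows "p dvd (\<Sum>m\<in>M. w m * poly q (int m))"
  using binom q
proof (induction K arbitrary: q)
  case 0
  then have "q = 0" by (metis bot_nat_0.extremum_uniqueI leading_coeff_0_iff)
  then show ?case by simp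
next
  case (Suc K)
  define P where "P = (\<Prod>i<Suc K. [:- int i, int n:])"
  have n: "n > 0" using p(2) by (cases n) auto
  have degP: "degree P = Suc K"
    unfolding P_def using n by (subst degree_prod_eq_sum_degree) auto
  have "lead_coeff P = int n ^ Suc K"
    unfolding P_def lead_coeff_prod using n by simp
  then have leadP: "coeff P (Suc K) = int n ^ Suc K" using degP by simp
  have P0: "coeff P 0 = 0"
    unfolding poly_0_coeff_0[symmetric] P_def poly_prod by (simp add: prod.lessThan_Suc_shift del: prod.lessThan_Suc)
  have polyP: "poly P (int m) = fact (Suc K) * int (n * m choose Suc K)" for m
    unfolding prod_diff_eq_fact_binomial[symmetric] P_def poly_prod
    by (rule prod.cong) (auto simp: mult.commute)
  \<comment> \<open>Cross-multiplication by leading coefficients cancels the top terms without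
    division, so only \<open>n\<close> has to be invertible, not the factorials.\<close>
  define r where "r = smult (int n ^ Suc K) q - smult (coeff q (Suc K)) P"
  have "degree r \<le> Suc K"
    unfolding r_def using Suc.prems(2) degP
    by (intro degree_diff_le) (auto intro: order.trans[OF degree_smult_le])
  moreover have "coeff r (Suc K) = 0" using leadP by (simp add: r_def)
  ultimately have "degree r \<le> K"
    by (metis degree_0 eq_zero_or_degree_less less_Suc_eq_le order_le_less zero_le)
  moreover have "coeff r 0 = 0" using Suc.prems(3) P0 by (simp add: r_def)
  ultimately have r: "p dvd (\<Sum>m\<in>M. w m * poly r (int m))"
    using Suc.IH Suc.prems(1) by simp
  have "(\<Sum>m\<in>M. w m * poly r (int m)) = int n ^ Suc K * (\<Sum>m\<in>M. w m * poly q (int m))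
      - coeff q (Suc K) * fact (Suc K) * (\<Sum>m\<in>M. w m * int (n * m choose Suc K))"
    unfolding r_def sum_distrib_left sum_subtractf[symmetric]
    by (rule sum.cong) (simp_all only: poly_diff poly_smult polyP, simp only: algebra_simps)
  moreover have "p dvd (\<Sum>m\<in>M. w m * int (n * m choose Suc K))"
    using Suc.prems(1) by simp
  ultimately have "p dvd int n ^ Suc K * (\<Sum>m\<in>M. w m * poly q (int m))"
    using r by (simp only: dvd_diff_left_iff dvd_mult)
  then show ?case
    using p prime_dvd_power[OF p(1), of "int n" "Suc K"]
    by (auto simp only: prime_dvd_mult_iff)
qed

section \<open>Test polynomials isolating one or two weights\<close>

lemma prod_lessThan_diff: "(\<Prod>i<k. int k - int i) = fact k"
  by (induction k) (simp_all add: prod.lessThan_Suc_shift del: prod.lessThan_Suc)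

lemma prime_not_dvd_fact:
  fixes p :: int
  assumes "prime p" "int k < p"
  shows "\<not> p dvd fact k"
  using assms(2)
proof (induction k)
  case 0
  then show ?case using assms(1) not_prime_unit by auto
next
  case (Suc k)
  then have "\<not> p dvd int (Suc k)" by (intro zdvd_not_zless) auto
  then show ?case using Suc assms(1) by (simp add: prime_dvd_mult_iff del: of_nat_Suc)
qed

text \<open>The test polynomial x (x - 1) ... (x - e + 1) kills all weights but the last, where its
  value is e!. Since e > 0 it has the root 0, as the moment condition demands.\<close>

lemma prime_dvd_top_weight:
  fixes p :: int and w :: "nat \<Rightarrow> int"
  assumes moment: "\<And>q. degree q \<le> e \<Longrightarrow> coeff q 0 = 0 \<Longrightarrow> p dvd (\<Sum>m\<le>e. w m * poly q (int m))"
    and "e > 0"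
  shows "p dvd w e * fact e"
proof -
  define q where "q = (\<Prod>i<e. [:- int i, 1:])"
  have poly_q: "poly q x = (\<Prod>i<e. x - int i)" for x
    unfolding q_def poly_prod by simp
  have "degree q \<le> e"
    unfolding q_def by (rule order.trans[OF degree_prod_sum_le]) auto
  moreover have "coeff q 0 = 0"
    unfolding poly_0_coeff_0[symmetric] poly_q using assms(2) by (auto intro!: prod_zero)
  moreover have "(\<Sum>m\<le>e. w m * poly q (int m)) = (\<Sum>m\<in>{e}. w m * poly q (int m))"
    unfolding poly_q by (intro sum.mono_neutral_right) (auto intro!: prod_zero)
  ultimately show ?thesis
    using moment[of q] by (simp add: poly_q prod_lessThan_diff)
qed

text \<open>The test polynomial has all of 0, ..., n - 1 except u and u + 1 as roots, so just two
  weights remain. The resulting recurrence is the one satisfied by the coefficients of (1 - y)^(n -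
  1).\<close>

lemma prime_dvd_adjacent_weights:
  fixes p :: int and w :: "nat \<Rightarrow> int"
  assumes p: "prime p" "int n < p" and u: "1 \<le> u" "Suc u < n"
    and moment: "\<And>q. degree q \<le> n - 2 \<Longrightarrow> coeff q 0 = 0 \<Longrightarrow> p dvd (\<Sum>m<n. w m * poly q (int m))"
  shows "p dvd w u * int (n - 1 - u) + w (Suc u) * int (Suc u)"
proof -
  define I where "I = {..<u} \<union> {u+2..<n}"
  define r where "r = n - (u + 2)"
  define B where "B = (\<Prod>j<r. - 1 - int j)"
  define q where "q = (\<Prod>i\<in>I. [:- int i, 1:])"
  have poly_q: "poly q x = (\<Prod>i\<in>I. x - int i)" for x
    unfolding q_def poly_prod by simp
  have finI: "finite I" by (simp add: I_def)
  have "card I = n - 2"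
    unfolding I_def using u by (subst card_Un_disjoint) auto
  then have "degree q \<le> n - 2"
    unfolding q_def by (intro order.trans[OF degree_prod_sum_le]) (auto simp: finI)
  moreover have "coeff q 0 = 0"
    unfolding poly_0_coeff_0[symmetric] poly_q using u finI
    by (auto intro!: prod_zero bexI[of _ 0] simp: I_def)
  moreover have "(\<Sum>m<n. w m * poly q (int m)) = (\<Sum>m\<in>{u, Suc u}. w m * poly q (int m))"
    unfolding poly_q using u finI by (intro sum.mono_neutral_right) (auto intro!: prod_zero simp: I_def)
  ultimately have *: "p dvd w u * poly q (int u) + w (Suc u) * poly q (int (Suc u))"
    using moment[of q] by simp
  have split: "poly q x = (\<Prod>i<u. x - int i) * (\<Prod>j<r. x - int (u + 2 + j))" for x
  proof -
    have "poly q x = (\<Prod>i<u. x - int i) * (\<Prod>i\<in>{u+2..<n}. x - int i)"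
      unfolding poly_q I_def by (rule prod.union_disjoint) auto
    also have "(\<Prod>i\<in>{u+2..<n}. x - int i) = (\<Prod>j<r. x - int (u + 2 + j))"
      by (rule prod.reindex_bij_witness[of _ "\<lambda>j. u + 2 + j" "\<lambda>i. i - (u + 2)"])
        (auto simp: r_def)
    finally show ?thesis .
  qed
  \<comment> \<open>Splitting off the first or the last factor of the same product compares the
    upper factors at \<open>u\<close> with those at \<open>Suc u\<close>, which form
    \<open>B\<close>.\<close>
  have "(\<Prod>j<Suc r. - 1 - int j) = - (\<Prod>j<r. - 2 - int j)"
    by (subst prod.lessThan_Suc_shift) (simp add: diff_diff_eq)
  then have "(\<Prod>j<r. - 2 - int j) = (1 + int r) * B"
    by (simp add: B_def algebra_simps)
  moreover have "int (n - 1 - u) = 1 + int r" using u by (simp add: r_def)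
  ultimately have "poly q (int u) = fact u * (int (n - 1 - u) * B)"
    by (simp add: split prod_lessThan_diff diff_diff_eq)
  moreover have "(\<Prod>i<u. int (Suc u) - int i) = fact (Suc u)"
    using prod_lessThan_diff[of "Suc u"] by simp
  then have "poly q (int (Suc u)) = fact (Suc u) * B"
    by (simp add: split B_def diff_diff_eq)
  ultimately have "p dvd fact u * B * (w u * int (n - 1 - u) + w (Suc u) * int (Suc u))"
    using * by (simp add: algebra_simps)
  moreover have "\<not> p dvd fact u"
    using p u by (intro prime_not_dvd_fact) auto
  moreover have "\<not> p dvd B"
  proof -
    have "\<not> p dvd - 1 - int j" if "j < r" for j
    proof -
      have "\<not> p dvd 1 + int j" using p u that by (intro zdvd_not_zless) (auto simp: r_def)
      then show ?thesis by (metis add_uminus_conv_diff dvd_minus_iff minus_add_distrib)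
    qed
    then show ?thesis unfolding B_def using p(1) by (simp add: prime_dvd_prod_iff)
  qed
  ultimately show ?thesis using p(1) by (simp add: prime_dvd_mult_iff)
qed

section \<open>Binomial coefficients along a residue class\<close>

lemma fact_add_eq_prod: "fact (x + n) = fact x * (\<Prod>i=1..n. x + i)" for x n :: nat
  by (induction n) (simp_all add: algebra_simps)

text \<open>Both sides are N! / (x! y!) with N = x + n + y. This is the ratio of binomial
  coefficients n places apart, cleared of denominators.\<close>

lemma binomial_shift_prod:
  "(x + n + y choose (x + n)) * (\<Prod>i=1..n. x + i) = (x + n + y choose x) * (\<Prod>i=1..n. y + i)"
proof -
  define z where "z = (fact x * fact y :: nat)"
  have "z * ((x + n + y choose (x + n)) * (\<Prod>i=1..n. x + i)) = fact (x + n + y)"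
    using binomial_fact_lemma[of "x + n" "x + n + y"] fact_add_eq_prod[of x n]
    by (simp add: z_def ac_simps)
  also have "\<dots> = z * ((x + n + y choose x) * (\<Prod>i=1..n. y + i))"
    using binomial_fact_lemma[of x "x + n + y"] fact_add_eq_prod[of y n]
    by (simp add: z_def ac_simps)
  finally show ?thesis by (simp add: z_def)
qed

lemma prime_not_dvd_binomial:
  fixes p :: int
  assumes "prime p" "int N < p" "k \<le> N"
  shows "\<not> p dvd int (N choose k)"
proof
  assume "p dvd int (N choose k)"
  moreover have "fact N = (fact k * fact (N - k) :: int) * int (N choose k)"
    using binomial_fact_lemma[OF assms(3)] by (metis of_nat_fact of_nat_mult)
  ultimately have "p dvd fact N" by simp
  then show False using prime_not_dvd_fact[OF assms(1,2)] by blast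
qed

text \<open>Trinomial revision gives binom(N, nm) binom(nm, k) = binom(N, k) binom(N - k, N - nm).
  Under i = N - nm the hypothesis on N turns the range of m into the condition that n divides i + 1,
  which is the surviving part of \<open>mult_subgroup_twisted_sum\<close> for T = N - k.\<close>

lemma binomial_sum_residue_class:
  assumes N: "Suc N = n * Suc e" and k: "1 \<le> k" "k \<le> N"
  shows "(\<Sum>m\<le>e. (-1) ^ (n * m) * int (N choose (n * m)) * int (n * m choose k)) =
    (-1) ^ N * int (N choose k) * (\<Sum>i | i \<le> N - k \<and> n dvd Suc i. (-1) ^ i * int (N - k choose i))"
proof -
  have n: "n > 0" using N by (cases n) auto
  have nm: "n * m \<le> N" if "m \<le> e" for m
  proof -
    have "n * m \<le> n * e" using that by (rule mult_le_mono2)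
    then show ?thesis using N n by (simp only: mult_Suc_right)
  qed
  have term_eq: "(-1) ^ (n * m) * int (N choose (n * m)) * int (n * m choose k) =
      (-1) ^ N * int (N choose k) * ((-1) ^ (N - n * m) * int (N - k choose (N - n * m)))"
    if m: "m \<le> e" "k \<le> n * m" for m
  proof -
    have "(N choose (n * m)) * (n * m choose k) = (N choose k) * (N - k choose (N - n * m))"
      using choose_mult[OF m(2) nm[OF m(1)]] binomial_symmetric[of "n * m - k" "N - k"] m nm[OF m(1)]
      by simp
    then have "int (N choose (n * m)) * int (n * m choose k) = int (N choose k) * int (N - k choose (N - n * m))"
      by (metis of_nat_mult)
    moreover have "(-1) ^ (n * m) = ((-1) ^ N * (-1) ^ (N - n * m) :: int)"
      using nm[OF m(1)] by (metis (no_types) add_diff_cancel_right' even_add le_add_diff_inverse2 minus_one_power_iff mult_minus1 mult_minus1_right mult_1 minus_minus)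
    ultimately show ?thesis by (simp add: mult.assoc mult.left_commute)
  qed
  have "(\<Sum>m\<le>e. (-1) ^ (n * m) * int (N choose (n * m)) * int (n * m choose k)) =
      (\<Sum>m | m \<le> e \<and> k \<le> n * m. (-1) ^ (n * m) * int (N choose (n * m)) * int (n * m choose k))"
    by (rule sum.mono_neutral_right) auto
  also have "\<dots> = (\<Sum>i | i \<le> N - k \<and> n dvd Suc i. (-1) ^ N * int (N choose k) * ((-1) ^ i * int (N - k choose i)))"
  proof (rule sum.reindex_bij_witness[of _ "\<lambda>i. (N - i) div n" "\<lambda>m. N - n * m"], goal_cases)
    case (1 m)
    then show ?case using nm[of m] n by simp
  next
    case (2 m)
    then have "Suc (N - n * m) = n * (Suc e - m)" using nm[of m] N by (simp add: diff_mult_distrib2 Suc_diff_le)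
    then show ?case using 2 nm[of m] by auto
  next
    case (3 i)
    then obtain t where t: "Suc i = n * t" by auto
    then have "N - i = n * (Suc e - t)" using N by (simp add: diff_mult_distrib2)
    then show ?case using 3 n k by auto
  next
    case (4 i)
    then obtain t where t: "Suc i = n * t" by auto
    then have *: "N - i = n * (Suc e - t)" using N by (simp add: diff_mult_distrib2)
    have "t \<ge> 1" using t by (cases t) auto
    then have "(N - i) div n \<le> e" using n unfolding * by simp
    moreover have "n * ((N - i) div n) = N - i" using n unfolding * by simp
    then have "k \<le> n * ((N - i) div n)" using 4 k by auto
    ultimately show ?case by simp
  next
    case (5 m)
    then show ?case using term_eq[of m] by simp
  qed
  finally show ?thesis by (simp add: sum_distrib_left)
qed

section \<open>Products over arithmetic progressions\<close>

text \<open>One family for the three products compared in \<open>arith_prod_not_cong\<close>, with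
  \<beta> equal to 1, -1 and -n.\<close>

definition arith_poly :: "int \<Rightarrow> int \<Rightarrow> nat \<Rightarrow> int poly" where
  "arith_poly \<alpha> \<beta> m = (\<Prod>i=1..m. [:\<alpha> + \<beta> * int i, 1:])"

lemma arith_poly_0: "arith_poly \<alpha> \<beta> 0 = 1"
  by (simp add: arith_poly_def)

lemma arith_poly_Suc: "arith_poly \<alpha> \<beta> (Suc m) = [:\<alpha> + \<beta> * (int m + 1), 1:] * arith_poly \<alpha> \<beta> m"
  by (simp add: arith_poly_def mult.commute add.commute)

lemma poly_arith_poly: "poly (arith_poly \<alpha> \<beta> m) x = (\<Prod>i=1..m. x + \<alpha> + \<beta> * int i)"
  unfolding arith_poly_def poly_prod by (simp add: algebra_simps)

lemma coeff_linear_mult_Suc: "coeff ([:a, 1:] * q) (Suc k) = a * coeff q (Suc k) + coeff q k"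
  for a :: int
  by (simp add: coeff_pCons)

lemma degree_arith_poly: "degree (arith_poly \<alpha> \<beta> m) \<le> m"
  unfolding arith_poly_def by (rule order.trans[OF degree_prod_sum_le]) auto

lemma coeff_arith_poly_0: "coeff (arith_poly \<alpha> \<beta> m) m = 1"
proof (induction m)
  case (Suc m)
  then show ?case
    using degree_arith_poly[of \<alpha> \<beta> m]
    by (simp add: arith_poly_Suc coeff_linear_mult_Suc coeff_eq_0 del: mult_pCons_left)
qed (simp add: arith_poly_0)

text \<open>Here and in the next two lemmas: the elementary symmetric functions of degree 1, 2, 3 of
  an arithmetic progression, scaled by 2, 24, 48 to clear denominators. Each follows by adjoining
  one linear factor at a time.\<close>

lemma coeff_arith_poly_1:
  "2 * coeff (arith_poly \<alpha> \<beta> (Suc m)) m = (int m + 1) * (2 * \<alpha> + \<beta> * (int m + 2))"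
proof (induction m)
  case 0
  show ?case by (simp add: arith_poly_Suc arith_poly_0)
next
  case (Suc m)
  have "2 * coeff (arith_poly \<alpha> \<beta> (Suc (Suc m))) (Suc m) =
      2 * (\<alpha> + \<beta> * (int m + 2)) + 2 * coeff (arith_poly \<alpha> \<beta> (Suc m)) m"
    by (subst arith_poly_Suc, subst coeff_linear_mult_Suc)
      (simp add: coeff_arith_poly_0 algebra_simps)
  then show ?case unfolding Suc by (simp add: algebra_simps)
qed

lemma coeff_arith_poly_2:
  "24 * coeff (arith_poly \<alpha> \<beta> (m + 2)) m =
    (int m + 1) * (int m + 2) *
      (12 * \<alpha>\<^sup>2 + 12 * (int m + 3) * \<alpha> * \<beta> + (int m + 3) * (3 * int m + 8) * \<beta>\<^sup>2)"
proof (induction m)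
  case 0
  show ?case by (simp add: arith_poly_Suc arith_poly_0 numeral_2_eq_2) (simp add: algebra_simps power2_eq_square)
next
  case (Suc m)
  have *: "24 * coeff (arith_poly \<alpha> \<beta> (m + 2)) (Suc m) = 12 * ((int m + 2) * (2 * \<alpha> + \<beta> * (int m + 3)))"
    using coeff_arith_poly_1[of \<alpha> \<beta> "Suc m"] by (simp add: algebra_simps)
  have "24 * coeff (arith_poly \<alpha> \<beta> (Suc m + 2)) (Suc m) =
     (\<alpha> + \<beta> * (int m + 3)) * (24 * coeff (arith_poly \<alpha> \<beta> (m + 2)) (Suc m)) + 24 * coeff (arith_poly \<alpha> \<beta> (m + 2)) m"
    by (simp only: add_Suc arith_poly_Suc coeff_linear_mult_Suc) (simp add: algebra_simps)
  also have "\<dots> = (int (Suc m) + 1) * (int (Suc m) + 2) *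
      (12 * \<alpha>\<^sup>2 + 12 * (int (Suc m) + 3) * \<alpha> * \<beta> + (int (Suc m) + 3) * (3 * int (Suc m) + 8) * \<beta>\<^sup>2)"
    unfolding * Suc by (simp add: algebra_simps power2_eq_square)
  finally show ?case .
qed

lemma coeff_arith_poly_3:
  "48 * coeff (arith_poly \<alpha> \<beta> (m + 3)) m =
    (int m + 1) * (int m + 2) * (int m + 3) *
      (8 * \<alpha>^3 + 12 * (int m + 4) * \<alpha>\<^sup>2 * \<beta> + 2 * (int m + 4) * (3 * int m + 11) * \<alpha> * \<beta>\<^sup>2
       + (int m + 3) * (int m + 4)\<^sup>2 * \<beta>^3)"
proof (induction m)
  case 0
  show ?case by (simp add: arith_poly_Suc arith_poly_0 numeral_3_eq_3)
      (simp add: algebra_simps power2_eq_square power3_eq_cube)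
next
  case (Suc m)
  have *: "48 * coeff (arith_poly \<alpha> \<beta> (m + 3)) (Suc m) =
      2 * ((int m + 2) * (int m + 3) *
      (12 * \<alpha>\<^sup>2 + 12 * (int m + 4) * \<alpha> * \<beta> + (int m + 4) * (3 * int m + 11) * \<beta>\<^sup>2))"
    using coeff_arith_poly_2[of \<alpha> \<beta> "Suc m"] by (simp add: algebra_simps numeral_3_eq_3)
  have "48 * coeff (arith_poly \<alpha> \<beta> (Suc m + 3)) (Suc m) =
     (\<alpha> + \<beta> * (int m + 4)) * (48 * coeff (arith_poly \<alpha> \<beta> (m + 3)) (Suc m)) + 48 * coeff (arith_poly \<alpha> \<beta> (m + 3)) m"
    by (simp only: add_Suc arith_poly_Suc coeff_linear_mult_Suc) (simp add: algebra_simps)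
  also have "\<dots> = (int (Suc m) + 1) * (int (Suc m) + 2) * (int (Suc m) + 3) *
      (8 * \<alpha>^3 + 12 * (int (Suc m) + 4) * \<alpha>\<^sup>2 * \<beta> + 2 * (int (Suc m) + 4) * (3 * int (Suc m) + 11) * \<alpha> * \<beta>\<^sup>2
       + (int (Suc m) + 3) * (int (Suc m) + 4)\<^sup>2 * \<beta>^3)"
    unfolding * Suc by (simp add: algebra_simps power2_eq_square power3_eq_cube)
  finally show ?case .
qed

lemma arith_prod_not_cong:
  fixes p :: int and n :: nat
  assumes p: "prime p" "int n + 1 < p" and n: "n \<ge> 4"
    and cong: "\<And>u. 1 \<le> u \<Longrightarrow> u \<le> n - 2 \<Longrightarrow>
      p dvd (\<Prod>i=1..n-1. int n * int u + int i)
          - (\<Prod>i=1..n-1. int n * int u - int n * (int n - 1) - int i)"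
  shows False
proof -
  define r where "r = n - 4"
  have n_r: "n = r + 4" "int n = int r + 4" using n by (simp_all add: r_def)
  \<comment> \<open>The factor n^2 (n - 1) is the leading coefficient of the difference of the first
    two products, whose degree is n - 2. After the subtraction the degree of \<open>T\<close> is
    below n - 2, the number of points in \<open>S\<close>.\<close>
  define T where "T = arith_poly 0 1 (r + 3) - arith_poly (- int n * (int n - 1)) (-1) (r + 3)
    - smult ((int n)\<^sup>2 * (int n - 1)) (arith_poly 0 (- int n) (r + 2))"
  define S where "S = (\<lambda>l. int n * int l) ` {1..r+2}"
  have ndvd: "\<not> p dvd int n" using p n by (intro zdvd_not_zless) auto
  have root: "p dvd poly T s" if s: "s \<in> S" for s
  proof -
    obtain u where u: "u \<in> {1..r+2}" "s = int n * int u" using s by (auto simp: S_def)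
    have "poly (arith_poly 0 (- int n) (r + 2)) s = 0"
      unfolding poly_arith_poly u(2) using u(1) by (intro prod_zero) auto
    moreover have "n - 1 = r + 3" "n - 2 = r + 2" using n_r by simp_all
    then have "p dvd poly (arith_poly 0 1 (r + 3)) s - poly (arith_poly (- int n * (int n - 1)) (-1) (r + 3)) s"
      using cong[of u] u unfolding poly_arith_poly by simp
    ultimately show ?thesis by (simp add: T_def)
  qed
  have distinct: "\<not> p dvd s - t" if st: "s \<in> S" "t \<in> S" "s \<noteq> t" for s t
  proof -
    obtain k l where kl: "k \<in> {1..r+2}" "l \<in> {1..r+2}" "s = int n * int k" "t = int n * int l"
      using st by (auto simp: S_def)
    then have "\<not> p dvd int k - int l"
      using p n_r st(3) by (intro residue_not_dvd_diff) auto
    moreover have "s - t = int n * (int k - int l)" using kl by (simp add: algebra_simps)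
    ultimately show ?thesis using ndvd p(1) by (simp add: prime_dvd_mult_iff)
  qed
  have "card S = r + 2"
    unfolding S_def using n by (subst card_image) (auto simp: inj_on_def)
  moreover have "degree T \<le> r + 1"
  proof (rule degree_le, intro allI impI)
    fix i assume i: "r + 1 < i"
    consider "i = r + 2" | "i = r + 3" | "i > r + 3" using i by linarith
    then show "coeff T i = 0"
    proof cases
      case 1
      have "2 * coeff T i = 0"
        using coeff_arith_poly_1[of 0 1 "r + 2"] coeff_arith_poly_1[of "- int n * (int n - 1)" "-1" "r + 2"]
          coeff_arith_poly_0[of 0 "- int n" "r + 2"]
        unfolding 1 T_def n_r(2) by (simp add: numeral_3_eq_3 algebra_simps power2_eq_square)
      then show ?thesis by simp
    next
      case 2
      have "degree (arith_poly 0 (- int n) (r + 2)) < r + 3"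
        using degree_arith_poly[of 0 "- int n" "r + 2"] by simp
      then show ?thesis
        unfolding 2 T_def by (simp add: coeff_arith_poly_0 coeff_eq_0)
    next
      case 3
      have "coeff (arith_poly \<alpha> \<beta> m) i = 0" if "m \<le> r + 3" for \<alpha> \<beta> m
        using degree_arith_poly[of \<alpha> \<beta> m] that 3 by (intro coeff_eq_0) simp
      then show ?thesis by (simp add: T_def)
    qed
  qed
  ultimately have "p dvd coeff T r"
    by (intro prime_dvd_coeff_if_many_roots[OF p(1), of S] root distinct) (auto simp: S_def)
  \<comment> \<open>Under z -> n (n - 1) - z both the difference of products and the product over
    \<open>S\<close> change only by the sign (-1)^n, so the coefficient of z^(n - 3) in
    \<open>T\<close> cancels identically. The first informative one is that of z^(n - 4), where r =
    n - 4.\<close>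
  moreover have "48 * coeff T r = 2 * (int n ^ 3 * (int n - 1)\<^sup>2 * (int n - 2) * (int n - 3) * (int n + 1)\<^sup>2)"
  proof -
    have "48 * coeff T r = 48 * coeff (arith_poly 0 1 (r + 3)) r
       - 48 * coeff (arith_poly (- int n * (int n - 1)) (-1) (r + 3)) r
       - 2 * (int n)\<^sup>2 * (int n - 1) * (24 * coeff (arith_poly 0 (- int n) (r + 2)) r)"
      by (simp add: T_def)
    then show ?thesis
      unfolding coeff_arith_poly_2 coeff_arith_poly_3 n_r(2)
      by (simp add: algebra_simps power2_eq_square power3_eq_cube)
  qed
  then have "int n ^ 3 * (int n - 1)\<^sup>2 * (int n - 2) * (int n - 3) * (int n + 1)\<^sup>2 = 24 * coeff T r"
    by linarith
  ultimately have "p dvd int n ^ 3 * (int n - 1)\<^sup>2 * (int n - 2) * (int n - 3) * (int n + 1)\<^sup>2"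
    by (simp only: dvd_mult)
  then have "p dvd int n \<or> p dvd int n - 1 \<or> p dvd int n - 2 \<or> p dvd int n - 3 \<or> p dvd int n + 1"
    using p(1) by (auto simp: prime_dvd_mult_iff dest: prime_dvd_power)
  then show False
    using p n zdvd_not_zless[of _ p] by auto
qed

section \<open>Subgroups whose differences form a coset\<close>

locale subgroup_difference_set =
  fixes p :: int and A \<Gamma> :: "int set" and \<xi> :: int and c :: nat
  assumes prime_p: "prime p"
    and subgroup_A: "mult_subgroup p A" and subgroup_\<Gamma>: "mult_subgroup p \<Gamma>"
    and \<xi>: "\<xi> \<in> {1..<p}"
    and diff_set_eq: "diff_set p A = dilate p \<xi> \<Gamma> \<union> {0}" and zero_notin: "0 \<notin> dilate p \<xi> \<Gamma>"
    and self_corr_eq: "\<And>x. x \<in> dilate p \<xi> \<Gamma> \<Longrightarrow> self_corr p A x = c"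
begin

abbreviation "n \<equiv> card A"
abbreviation "d \<equiv> card \<Gamma>"

section \<open>Counting constraints on A and \<Gamma>\<close>

lemma dilate_eq: "dilate p \<xi> \<Gamma> = diff_set p A - {0}"
  using diff_set_eq zero_notin by auto

lemma diff_mod_in_dilate: "a \<in> A \<Longrightarrow> b \<in> A \<Longrightarrow> a \<noteq> b \<Longrightarrow> (a - b) mod p \<in> dilate p \<xi> \<Gamma>"
  unfolding dilate_eq diff_set_def using mult_subgroup_not_dvd_diff[OF subgroup_A, of a b]
  by (auto simp: dvd_eq_mod_eq_0)

lemma card_dilate: "card (dilate p \<xi> \<Gamma>) = d"
proof -
  have "dilate p \<xi> \<Gamma> = (\<lambda>g. (g * \<xi>) mod p) ` \<Gamma>"
    by (auto simp: dilate_def mult.commute)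
  moreover have "inj_on (\<lambda>g. (g * \<xi>) mod p) \<Gamma>"
    using prime_p subgroup_\<Gamma> \<xi> zdvd_not_zless[of \<xi> p]
    by (intro inj_on_mult_mod) (auto simp: mult_subgroup_def)
  ultimately show ?thesis by (simp add: card_image)
qed

text \<open>Sort the ordered pairs of distinct elements of \<open>A\<close> by their difference:
  each of the \<open>d\<close> classes has \<open>c\<close> members.\<close>

lemma card_square: "n ^ 2 - n = c * d"
proof -
  have fin: "finite A" using mult_subgroup_finite[OF subgroup_A] .
  define F where "F x = {(a, a'). a \<in> A \<and> a' \<in> A \<and> (a' - a) mod p = x}" for x
  have finF: "finite (F x)" for x
    by (rule finite_subset[of _ "A \<times> A"]) (auto simp: F_def fin)
  have "A \<times> A - Id_on A = (\<Union>x\<in>dilate p \<xi> \<Gamma>. F x)"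
    using diff_mod_in_dilate zero_notin by (auto simp: F_def)
  also have "card \<dots> = (\<Sum>x\<in>dilate p \<xi> \<Gamma>. card (F x))"
    using finF mult_subgroup_finite[OF subgroup_\<Gamma>]
    by (intro card_UN_disjoint) (auto simp: F_def dilate_def)
  also have "\<dots> = c * d"
    using self_corr_eq by (simp add: F_def self_corr_def card_dilate)
  finally have "card (A \<times> A - Id_on A) = c * d" .
  moreover have "Id_on A = (\<lambda>a. (a, a)) ` A" by auto
  then have "card (Id_on A) = n" by (simp add: card_image inj_on_def)
  moreover have "card (A \<times> A - Id_on A) = card (A \<times> A) - card (Id_on A)"
    using fin by (intro card_Diff_subset finite_subset[OF Id_on_subset_Times]) auto
  ultimately show ?thesis
    by (simp add: card_cartesian_product power2_eq_square)
qed

text \<open>Multiplying a difference of elements of \<open>A\<close> by an element of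
  \<open>A\<close> gives another such difference, so the set of nonzero differences, of size
  \<open>d\<close>, is a union of \<open>A\<close>-orbits.\<close>

lemma card_A_dvd: "n dvd d"
proof -
  have "card A dvd card (dilate p \<xi> \<Gamma>)"
  proof (rule mult_subgroup_card_dvd[OF prime_p subgroup_A])
    show "dilate p \<xi> \<Gamma> \<subseteq> {1..<p}"
    proof
      fix x assume "x \<in> dilate p \<xi> \<Gamma>"
      moreover from this obtain y where "x = y mod p" by (auto simp: dilate_def)
      moreover have "0 \<le> y mod p" "y mod p < p" using prime_gt_0_int[OF prime_p] by auto
      ultimately show "x \<in> {1..<p}" using zero_notin by (cases "x = 0") auto
    qed
  next
    fix a x assume a: "a \<in> A" and "x \<in> dilate p \<xi> \<Gamma>"
    then obtain b b' where b: "b \<in> A" "b' \<in> A" "x = (b - b') mod p" "x \<noteq> 0"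
      unfolding dilate_eq diff_set_def by auto
    have "(a * b) mod p \<in> A" "(a * b') mod p \<in> A"
      using a b subgroup_A by (auto simp: mult_subgroup_def)
    moreover have "(a * x) mod p = ((a * b) mod p - (a * b') mod p) mod p"
      unfolding b(3) by (simp add: mod_simps algebra_simps)
    moreover have "(a * b) mod p \<noteq> (a * b') mod p"
    proof
      assume "(a * b) mod p = (a * b') mod p"
      then have "p dvd a * (b - b')" by (simp add: mod_eq_dvd_iff algebra_simps)
      then show False
        using prime_p mult_subgroup_not_dvd[OF subgroup_A a] b(3,4)
        by (auto simp: prime_dvd_mult_iff)
    qed
    ultimately show "(a * x) mod p \<in> dilate p \<xi> \<Gamma>" using diff_mod_in_dilate by simp
  qed
  then show ?thesis by (simp add: card_dilate)
qed

text \<open>A proper subgroup has index at least 2. Together with n \<le> d this keeps N = d + n - 1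
  below \<open>p\<close>, which makes the binomial coefficients of N units.\<close>

lemma card_\<Gamma>_proper:
  assumes "\<Gamma> \<noteq> {1..<p}"
  shows "2 * int d < p"
proof -
  have sub: "\<Gamma> \<subseteq> {1..<p}" using subgroup_\<Gamma> by (simp add: mult_subgroup_def)
  have "d dvd card {1..<p}"
  proof (rule mult_subgroup_card_dvd[OF prime_p subgroup_\<Gamma>])
    fix a x assume a: "a \<in> \<Gamma>" and x: "x \<in> {1..<p}"
    have "\<not> p dvd a * x"
      using prime_p mult_subgroup_not_dvd[OF subgroup_\<Gamma> a] x zdvd_not_zless[of x p]
      by (simp add: prime_dvd_mult_iff)
    moreover have "0 \<le> (a * x) mod p" "(a * x) mod p < p" using prime_gt_0_int[OF prime_p] by auto
    ultimately show "(a * x) mod p \<in> {1..<p}"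
      by (cases "(a * x) mod p = 0") (auto simp: dvd_eq_mod_eq_0)
  qed simp
  then obtain k where k: "nat (p - 1) = d * k" by auto
  have "k \<noteq> 0" using k prime_gt_1_int[OF prime_p] by (cases "k = 0") auto
  moreover have "k \<noteq> 1" using k sub assms card_subset_eq[OF _ sub] by auto
  ultimately have "d * 2 \<le> nat (p - 1)" unfolding k by simp
  then show ?thesis using prime_gt_1_int[OF prime_p] by linarith
qed

section \<open>Stepanov's method for the differences\<close>

text \<open>All nonzero differences lie in one coset of \<Gamma>, on which the \<open>d\<close>-th
  power is constant.\<close>

lemma diff_power_d:
  assumes "a \<in> A" "b \<in> A" "a \<noteq> b"
  shows "[(a - b) ^ d = \<xi> ^ d] (mod p)"
proof -
  obtain g where g: "g \<in> \<Gamma>" "(a - b) mod p = (\<xi> * g) mod p"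
    using diff_mod_in_dilate[OF assms] by (auto simp: dilate_def)
  have "[(a - b) ^ d = (\<xi> * g) ^ d] (mod p)"
    by (rule cong_pow) (use g in \<open>simp add: cong_def\<close>)
  also have "(\<xi> * g) ^ d = \<xi> ^ d * g ^ d" by (simp add: power_mult_distrib)
  also have "[\<dots> = \<xi> ^ d * 1] (mod p)"
    by (intro cong_mult cong_refl mult_subgroup_power_card prime_p subgroup_\<Gamma> g)
  finally show ?thesis by simp
qed

text \<open>Away from a = 1 the factor (1 - a)^d is the constant \<xi>^d, so \<open>d\<close> drops
  out of the exponent, and the remaining sum meets no exponent divisible by
  \<open>n\<close>.\<close>

lemma twisted_sum_shift:
  assumes "1 \<le> T" "Suc T < n"
  shows "[(\<Sum>a\<in>A. a * (1 - a) ^ (d + T)) = 0] (mod p)"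
proof -
  have one: "1 \<in> A" using subgroup_A by (simp add: mult_subgroup_def)
  have "[(\<Sum>a\<in>A. a * (1 - a) ^ (d + T)) = (\<Sum>a\<in>A. \<xi> ^ d * (a * (1 - a) ^ T))] (mod p)"
  proof (rule cong_sum)
    fix a assume a: "a \<in> A"
    show "[a * (1 - a) ^ (d + T) = \<xi> ^ d * (a * (1 - a) ^ T)] (mod p)"
    proof (cases "a = 1")
      \<comment> \<open>The term a = 1 vanishes on both sides because T \<ge> 1; for T = 0 the right
        side would keep \<xi>^d.\<close>
      case True
      then show ?thesis using assms(1) by (simp add: power_0_left)
    next
      case False
      have "[(1 - a) ^ d * (a * (1 - a) ^ T) = \<xi> ^ d * (a * (1 - a) ^ T)] (mod p)"
        using diff_power_d[OF one a] False by (intro cong_mult cong_refl) auto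
      then show ?thesis by (simp add: power_add mult.left_commute)
    qed
  qed
  also have "(\<Sum>a\<in>A. \<xi> ^ d * (a * (1 - a) ^ T)) = \<xi> ^ d * (\<Sum>a\<in>A. a * (1 - a) ^ T)"
    by (simp add: sum_distrib_left)
  also have "[\<dots> = \<xi> ^ d * 0] (mod p)"
    by (intro cong_mult cong_refl mult_subgroup_twisted_sum_eq_0 prime_p subgroup_A assms)
  finally show ?thesis by simp
qed

text \<open>The sum is the k-th Hasse derivative at 1 of the polynomial in x^n with the signed
  binomials as coefficients. It vanishes since N - k = d + T with T = n - 1 - k, and the bounds on k
  are those of \<open>twisted_sum_shift\<close> for this T.\<close>

lemma binomial_moment:
  assumes d: "d = n * e" and N: "N = d + n - 1" and k: "1 \<le> k" "k + 2 \<le> n" and n: "\<not> p dvd int n"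
  shows "p dvd (\<Sum>m\<le>e. (-1) ^ (n * m) * int (N choose (n * m)) * int (n * m choose k))"
proof -
  have "N - k = d + (n - 1 - k)" using N k by simp
  then have "[(\<Sum>a\<in>A. a * (1 - a) ^ (N - k)) = 0] (mod p)"
    using twisted_sum_shift[of "n - 1 - k"] k by simp
  then have "[0 = (\<Sum>a\<in>A. a * (1 - a) ^ (N - k))] (mod p)"
    by (rule cong_sym)
  also have "[(\<Sum>a\<in>A. a * (1 - a) ^ (N - k)) = (\<Sum>i\<le>N - k. (-1) ^ i * int (N - k choose i) * (if n dvd Suc i then int n else 0))] (mod p)"
    by (rule mult_subgroup_twisted_sum[OF prime_p subgroup_A])
  also have "(\<Sum>i\<le>N - k. (-1) ^ i * int (N - k choose i) * (if n dvd Suc i then int n else 0)) =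
      (\<Sum>i | i \<le> N - k \<and> n dvd Suc i. (-1) ^ i * int (N - k choose i) * int n)"
    by (rule sum.mono_neutral_cong_right) auto
  also have "\<dots> = (\<Sum>i | i \<le> N - k \<and> n dvd Suc i. (-1) ^ i * int (N - k choose i)) * int n"
    by (simp add: sum_distrib_right)
  finally have "p dvd (\<Sum>i | i \<le> N - k \<and> n dvd Suc i. (-1) ^ i * int (N - k choose i))"
    using prime_p n by (simp add: cong_iff_dvd_diff prime_dvd_mult_iff)
  moreover have "Suc N = n * Suc e" "k \<le> N" using N d k by auto
  ultimately show ?thesis
    using k by (subst binomial_sum_residue_class) (auto simp: dvd_mult)
qed

lemma card_A_le_3:
  assumes proper: "\<Gamma> \<noteq> {1..<p}"
  shows "n \<le> 3"
proof (rule ccontr)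
  assume "\<not> n \<le> 3"
  then have n: "n \<ge> 4" by simp
  obtain e where e: "d = n * e" using card_A_dvd by blast
  have "d > 0"
    using mult_subgroup_finite[OF subgroup_\<Gamma>] subgroup_\<Gamma> by (auto simp: mult_subgroup_def card_gt_0_iff)
  then have e0: "e > 0" and nd: "n \<le> d" using e by (auto intro: dvd_imp_le)
  define N where "N = d + n - 1"
  have N_less: "int N < p" using card_\<Gamma>_proper[OF proper] nd n by (simp add: N_def)
  have n_less: "int n < p" using N_less nd n by (simp add: N_def)
  have not_dvd: "\<not> p dvd int k" if "0 < k" "k \<le> N" for k
    using that N_less by (intro zdvd_not_zless) auto
  define w where "w m = (-1) ^ (n * m) * int (N choose (n * m))" for m
  have moment: "p dvd (\<Sum>m\<le>e. w m * poly q (int m))" if "degree q \<le> n - 2" "coeff q 0 = 0" for q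
  proof (rule prime_dvd_poly_moment[OF prime_p _ _ that, of n])
    show "\<not> p dvd int n" using n n_less by (intro zdvd_not_zless) auto
    then show "p dvd (\<Sum>m\<le>e. w m * int (n * m choose k))" if "1 \<le> k" "k \<le> n - 2" for k
      using binomial_moment[OF e N_def, of k] that n by (simp add: w_def)
  qed
  \<comment> \<open>Otherwise e \<le> n - 2, so the moments reach degree e and isolate
    \<open>w e\<close>, which is up to sign the unit binom(N, d).\<close>
  have "n - 1 \<le> e"
  proof (rule ccontr)
    assume "\<not> n - 1 \<le> e"
    then have "p dvd w e * fact e"
      by (intro prime_dvd_top_weight moment e0) auto
    moreover have "e \<le> d" using e n by simp
    then have "\<not> p dvd fact e"
      using N_less n by (intro prime_not_dvd_fact prime_p) (auto simp: N_def)
    moreover have "\<not> p dvd w e"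
      using prime_not_dvd_binomial[OF prime_p N_less, of "n * e"] e n
      by (simp add: w_def N_def minus_one_power_iff)
    ultimately show False using prime_p by (simp add: prime_dvd_mult_iff)
  qed
  \<comment> \<open>Counting pairs gives n - 1 = c e; with e \<ge> n - 1 this leaves only c =
    1.\<close>
  moreover have "n * (n - 1) = n * (c * e)"
    using card_square e by (simp add: power2_eq_square algebra_simps)
  then have "n - 1 = c * e" using n by (simp only: mult_cancel1) auto
  moreover have "c \<noteq> 0" using \<open>n - 1 = c * e\<close> n by (intro notI) simp
  ultimately have e_eq: "e = n - 1" by (cases c) auto
  have N_eq: "Suc N = n * n" using e e_eq n by (simp add: N_def algebra_simps)
  show False
  proof (rule arith_prod_not_cong[OF prime_p _ n])
    show "int n + 1 < p" using N_less nd n by (simp add: N_def)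
  next
    fix u assume u: "1 \<le> u" "u \<le> n - 2"
    \<comment> \<open>\<open>v\<close> is the mirror image of \<open>u\<close> in 0, ..., n - 1.
      Below, \<open>G t\<close> is the product of the integers strictly between n t and n (t +
      1).\<close>
    define v where "v = n - 1 - u"
    have v: "v \<ge> 1" "n = Suc (u + v)" "int v = int n - 1 - int u" using u n by (auto simp: v_def)
    define G where "G t = (\<Prod>i=1..n-1. int n * int t + int i)" for t
    define b b' where "b = int (N choose (n * u))" and "b' = int (N choose (n * Suc u))"
    have "{..e} = {..<n}" using e_eq n by auto
    then have "p dvd w u * int v + w (Suc u) * int (Suc u)"
      using prime_dvd_adjacent_weights[OF prime_p n_less u(1), of w] moment u n
      by (simp add: v_def)
    moreover have "w u * int v + w (Suc u) * int (Suc u) =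
        (-1) ^ (n * u) * (b * int v + (-1) ^ n * b' * int (Suc u))"
      by (simp add: w_def b_def b'_def power_add algebra_simps)
    moreover have "\<not> p dvd (-1) ^ (n * u)"
      using prime_p not_prime_unit by (auto simp: minus_one_power_iff)
    ultimately have "p dvd b * int v + (-1) ^ n * b' * int (Suc u)"
      using prime_p by (simp only: prime_dvd_mult_iff) blast
    \<comment> \<open>The factor n G(u) lets \<open>shift\<close> trade \<open>b'\<close> for
      \<open>b\<close>, which then cancels as a unit.\<close>
    then have scaled: "p dvd int n * G u * (b * int v + (-1) ^ n * b' * int (Suc u))" by simp
    have shift: "b' * (int n * int (Suc u) * G u) = b * (int n * int v * G v)"
    proof -
      \<comment> \<open>This y makes n u + n + y = N. Of the n integers following n u, the last is n
        (u + 1) and the others form G(u); of those following y, the first is n v and the others form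
        G(v).\<close>
      define y where "y = n * v - 1"
      have y: "Suc y = n * v" using v n by (simp add: y_def)
      have N_split: "N = n * u + n + y"
      proof -
        have "n * n = n * u + n + n * v" by (subst (2) v(2)) (simp add: algebra_simps)
        then show ?thesis using N_eq y by simp
      qed
      have "int (\<Prod>i=1..n. n * u + i) = (int n * int (Suc u)) * G u"
        by (subst (1) v(2)) (simp add: v(2) G_def algebra_simps)
      moreover have "int (\<Prod>i=1..n. y + i) = (int n * int v) * G v"
      proof -
        have "(\<Prod>i=1..n. y + i) = (\<Prod>i=0..u+v. Suc y + i)"
          by (subst v(2), subst One_nat_def, subst prod.atLeast_Suc_atMost_Suc_shift) simp
        also have "\<dots> = n * v * (\<Prod>i=1..u+v. n * v + i)"
          unfolding y by (subst prod.atLeast_Suc_atMost) auto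
        finally have "int (\<Prod>i=1..n. y + i) = int (n * v * (\<Prod>i=1..u+v. n * v + i))"
          by (rule arg_cong)
        moreover have "n - 1 = u + v" using v(2) by simp
        ultimately show ?thesis unfolding G_def by simp
      qed
      ultimately show ?thesis
        using binomial_shift_prod[of "n * u" n y]
        unfolding b_def b'_def N_split[symmetric]
        by (metis mult_Suc_right add.commute of_nat_mult)
    qed
    have "int n * G u * (b * int v + (-1) ^ n * b' * int (Suc u)) =
        int n * G u * b * int v + (-1) ^ n * (b' * (int n * int (Suc u) * G u))"
      by (simp only: algebra_simps)
    also have "\<dots> = int n * int v * b * (G u + (-1) ^ n * G v)"
      unfolding shift by (simp only: algebra_simps)
    finally have "p dvd int n * int v * b * (G u + (-1) ^ n * G v)"
      using scaled by (rule subst)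
    moreover have "n * u \<le> N"
    proof -
      have "n * u < n * n" using u n by simp
      then show ?thesis using N_eq by linarith
    qed
    then have "\<not> p dvd b"
      unfolding b_def by (intro prime_not_dvd_binomial prime_p N_less)
    moreover have "\<not> p dvd int n"
      by (rule not_dvd) (use n nd in \<open>simp_all add: N_def\<close>)
    moreover have "\<not> p dvd int v"
      by (rule not_dvd) (use v(1) u nd in \<open>simp_all add: N_def v_def\<close>)
    ultimately have "p dvd G u + (-1) ^ n * G v"
      using prime_p by (auto simp: prime_dvd_mult_iff)
    \<comment> \<open>Since u = n - 1 - v, each factor is -(n v + i): the second product is G(v)
      reflected.\<close>
    moreover have "(\<Prod>i=1..n-1. int n * int u - int n * (int n - 1) - int i) = (-1) ^ (n - 1) * G v"
    proof -
      have "(\<Prod>i=1..n-1. int n * int u - int n * (int n - 1) - int i) =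
          (\<Prod>i=1..n-1. (-1) * (int n * int v + int i))"
        unfolding v(3) by (intro prod.cong) (simp_all add: algebra_simps)
      also have "\<dots> = (-1) ^ (n - 1) * G v"
        unfolding G_def prod.distrib by simp
      finally show ?thesis .
    qed
    moreover have "(-1) ^ n = - ((-1) ^ (n - 1) :: int)"
      using n by (cases n) auto
    ultimately show "p dvd (\<Prod>i=1..n-1. int n * int u + int i)
          - (\<Prod>i=1..n-1. int n * int u - int n * (int n - 1) - int i)"
      by (simp add: G_def)
  qed
qed

lemma card_\<Gamma>_alternative:
  "real d \<le> 6 \<or> real d \<ge> 1 / 4 * real_of_int p / ln (real_of_int p)"
proof (cases "\<Gamma> = {1..<p}")
  case True
  have p: "p \<ge> 2" using prime_ge_2_int[OF prime_p] .
  \<comment> \<open>The constant 1/4 comes from ln p \<ge> 1/2 and p - 1 \<ge> p/2: the bound is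
    then at most p/2, hence at most d = p - 1.\<close>
  have "1 / 2 \<le> ln (2 :: real)" by (subst ln_ge_iff) (simp_all add: exp_half_le2)
  also have "\<dots> \<le> ln (real_of_int p)" using p by simp
  finally have ln: "1 / 2 \<le> ln (real_of_int p)" .
  have "1 / 4 * real_of_int p / ln (real_of_int p) \<le> 1 / 4 * real_of_int p / (1 / 2)"
    using ln p by (intro divide_left_mono) auto
  also have "\<dots> \<le> real d" using p True by simp
  finally show ?thesis by simp
next
  case False
  have n: "n \<le> 3" using card_A_le_3[OF False] .
  have "n \<noteq> 1"
  proof
    assume "n = 1"
    then obtain a where "A = {a}" by (auto simp: card_1_singleton_iff)
    then have "dilate p \<xi> \<Gamma> = {}" unfolding dilate_eq diff_set_def by auto
    then show False using subgroup_\<Gamma> by (auto simp: dilate_def mult_subgroup_def)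
  qed
  moreover have "n \<noteq> 0"
    using mult_subgroup_finite[OF subgroup_A] subgroup_A by (auto simp: mult_subgroup_def)
  ultimately have "n = 2 \<or> n = 3" using n by linarith
  \<comment> \<open>Here n (n - 1) is 2 or 6 and \<open>d\<close> divides it, whence the bound
    6.\<close>
  then have "c * d = 2 \<or> c * d = 6" using card_square by auto
  then have "d \<le> 6" by (cases c) auto
  then show ?thesis by simp
qed

end

theorem theorem4:
  "\<exists>C1 C2 :: real. C1 > 0 \<and> C2 > 0 \<and>
    (\<forall>(p::int) A \<Gamma> \<xi> (c::nat).
      prime p \<longrightarrow> mult_subgroup p A \<longrightarrow> mult_subgroup p \<Gamma> \<longrightarrow>
      \<xi> \<in> {1..<p} \<longrightarrow>
      diff_set p A = dilate p \<xi> \<Gamma> \<union> {0} \<longrightarrow> 0 \<notin> dilate p \<xi> \<Gamma> \<longrightarrow>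
      (\<forall>x\<in>dilate p \<xi> \<Gamma>. self_corr p A x = c) \<longrightarrow>
      card A ^ 2 - card A = c * card \<Gamma> \<and>
      (real (card \<Gamma>) \<le> C1 \<or> real (card \<Gamma>) \<ge> C2 * real_of_int p / ln (real_of_int p)))"
proof (rule exI[of _ 6], rule exI[of _ "1 / 4"], intro conjI allI impI, goal_cases)
  case (3 p A \<Gamma> \<xi> c)
  then interpret subgroup_difference_set p A \<Gamma> \<xi> c by unfold_locales auto
  show ?case by (rule card_square)
next
  case (4 p A \<Gamma> \<xi> c)
  then interpret subgroup_difference_set p A \<Gamma> \<xi> c by unfold_locales auto
  show ?case by (rule card_\<Gamma>_alternative)
qed simp_all

end
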